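(* For $n\ge3$, the characteristic polynomial of the Coxeter transformation of the diagram $T_{2,4,n}$, taken up to sign, is $$\chi(T_{2,4,n})=\lambda^{n+4}+\lambda^{n+3}-\lambda^{n+1}-2\sum_{i=4}^{n}\lambda^i-\lambda^3+\lambda+1$$ (the sum being empty for $n=3$), in other words $$\chi(T_{2,4,n})=\frac{\lambda^{n+1}(\lambda^4-\lambda^2-\lambda-1)+(\lambda^4+\lambda^3+\lambda^2-1)}{\lambda-1}=\frac{(\lambda+1)\big(\lambda^{n+1}(\lambda^3-\lambda^2-1)+(\lambda^3+\lambda-1)\big)}{\lambda-1}.$$ As $n\to\infty$, the spectral radius $\rho(T_{2,4,n})$ of the Coxeter transformation converges to the maximal root $\rho_{max}$ of the equation $\lambda^3-\lambda^2-1=0$, and $$\rho_{max}=\tfrac13+\sqrt[3]{\tfrac{58}{108}+\sqrt{\tfrac{31}{108}}}+\sqrt[3]{\tfrac{58}{108}-\sqrt{\tfrac{31}{108}}}\approx1.465571.$$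
   Context: $T_{p,q,r}$ is the simply-laced star-shaped tree with three branches having $p,q,r$ vertices respectively, each count including the common branch vertex (so $p+q+r-2$ vertices in total). The Coxeter transformation of a tree with Cartan matrix $K$ is the product of all simple reflections $\sigma_v(z)=z-(Kz)_v\alpha_v$, each taken once, in some order; for a tree all such products are conjugate. "Maximal root" means the largest real root. *)

theory Defs
  imports Complex_Main "Jordan_Normal_Form.Spectral_Radius"
begin

text \<open>
  A diagram on the vertices \<open>0, \<dots>, N - 1\<close> is given by its set of undirected edges.
\<close>

definition path_edges :: "nat list \<Rightarrow> nat set set" where
  "path_edges xs = {{xs ! i, xs ! Suc i} | i. Suc i < length xs}"

text \<open>
  Vertices of \<open>T\<^bsub>p,q,r\<^esub>\<close> for \<open>p, q, r \<ge> 1\<close>: the branch vertex is \<open>0\<close>, and the three blocks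
  of \<open>p - 1\<close>, \<open>q - 1\<close> and \<open>r - 1\<close> further vertices are numbered consecutively, each block
  outwards from the branch vertex.
\<close>

definition star_order :: "nat \<Rightarrow> nat \<Rightarrow> nat \<Rightarrow> nat" where
  "star_order p q r = p + q + r - 2"

definition star_edges :: "nat \<Rightarrow> nat \<Rightarrow> nat \<Rightarrow> nat set set" where
  "star_edges p q r =
     path_edges (0 # [1..<p]) \<union>
     path_edges (0 # [p..<p + q - 1]) \<union>
     path_edges (0 # [p + q - 1..<p + q + r - 2])"

definition cartan_matrix :: "nat \<Rightarrow> nat set set \<Rightarrow> real mat" where
  "cartan_matrix N E =
     mat N N (\<lambda>(i, j). if i = j then 2 else if {i, j} \<in> E then -1 else 0)"

text \<open>The simple roots \<open>\<alpha>\<^sub>v\<close> are the unit vectors.\<close>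

definition simple_reflection :: "real mat \<Rightarrow> nat \<Rightarrow> real vec \<Rightarrow> real vec" where
  "simple_reflection K v z = z - ((K *\<^sub>v z) $ v) \<cdot>\<^sub>v unit_vec (dim_row K) v"

definition simple_reflection_mat :: "real mat \<Rightarrow> nat \<Rightarrow> real mat" where
  "simple_reflection_mat K v =
     mat_of_cols (dim_row K)
       (map (\<lambda>j. simple_reflection K v (unit_vec (dim_row K) j)) [0..<dim_row K])"

lemma simple_reflection_mat_mult_vec:
  assumes K: "K \<in> carrier_mat N N" and v: "v < N" and z: "z \<in> carrier_vec N"
  shows "simple_reflection_mat K v *\<^sub>v z = simple_reflection K v z"
proof (rule eq_vecI)
  have col: "(K *\<^sub>v unit_vec N j) $ v = K $$ (v, j)" if "j < N" for j
    using that K v by (simp add: scalar_prod_right_unit)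
  fix i assume "i < dim_vec (simple_reflection K v z)"
  then have i: "i < N" using K by (simp add: simple_reflection_def)
  have entry: "simple_reflection_mat K v $$ (i, j) =
      (if i = j then 1 else 0) - (if i = v then K $$ (v, j) else 0)" if j: "j < N" for j
    using i v K col j
    by (auto simp: simple_reflection_mat_def simple_reflection_def mat_of_cols_index)
  have "(simple_reflection_mat K v *\<^sub>v z) $ i = (\<Sum>j\<in>{0..<N}. simple_reflection_mat K v $$ (i, j) * z $ j)"
    using i K z by (simp add: simple_reflection_mat_def scalar_prod_def)
  also have "\<dots> = (\<Sum>j\<in>{0..<N}. (if i = j then z $ j else 0) - (if i = v then K $$ (v, j) * z $ j else 0))"
    by (rule sum.cong) (auto simp: entry algebra_simps)
  also have "\<dots> = z $ i - (if i = v then \<Sum>j\<in>{0..<N}. K $$ (v, j) * z $ j else 0)"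
    using i by (simp add: sum_subtractf)
  also have "\<dots> = simple_reflection K v z $ i"
    using i K z v by (simp add: simple_reflection_def scalar_prod_def)
  finally show "(simple_reflection_mat K v *\<^sub>v z) $ i = simple_reflection K v z $ i" .
qed (use K in \<open>simp add: simple_reflection_mat_def simple_reflection_def\<close>)

text \<open>
  The Coxeter transformation depends on the chosen order of the vertices (up to conjugacy
  only, for a tree), so it is a predicate: \<open>C\<close> is the product of all simple
  reflections, each taken once, in some order.
\<close>

definition is_coxeter_transformation :: "real mat \<Rightarrow> real mat \<Rightarrow> bool" where
  "is_coxeter_transformation K C \<longleftrightarrow>
     (\<exists>vs. distinct vs \<and> set vs = {..<dim_row K} \<and>
        C = foldr (\<lambda>v M. simple_reflection_mat K v * M) vs (1\<^sub>m (dim_row K)))"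

definition rho_max :: real where
  "rho_max = Max {x :: real. x ^ 3 - x ^ 2 - 1 = 0}"

end

theory Submission
  imports Defs
begin

text \<open>
  List the vertices in the order in which their reflections are multiplied, and let \<open>U\<close> be the
  unipotent matrix that keeps the entries of the Cartan matrix \<open>K\<close> between a vertex and the
  vertices after it, so that \<open>K = U + U\<^sup>T\<close>. Applying the reflections one at a time amounts to
  solving a triangular system, and the outcome is \<open>U C = - U\<^sup>T\<close>
  (\<open>order_splitting_times_coxeter\<close>). Hence the characteristic polynomial of \<open>C\<close> is
  \<open>det (x U + U\<^sup>T)\<close>. This matrix has \<open>x + 1\<close> on the diagonal, and the two entries belonging to
  an edge are \<open>- x\<close> and \<open>- 1\<close>, in one order or the other. Expanding a determinant at a leaf of a
  tree involves those two entries only through their product \<open>x\<close>, which is why the order of the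
  vertices disappears from the answer.

  Let \<open>D\<^bsub>m\<^esub>\<close> be the leading minor of order \<open>m\<close>. Removing the outermost vertex of the long branch
  gives the recurrence \<open>D\<^bsub>m+2\<^esub> = (x + 1) D\<^bsub>m+1\<^esub> - x D\<^bsub>m\<^esub>\<close>. Its characteristic roots are \<open>x\<close> and \<open>1\<close>, so
  \<open>(x - 1) D\<^bsub>m\<^esub>\<close> is a fixed polynomial times a power of \<open>x\<close> plus another fixed polynomial
  (\<open>star_det_coxeter\<close>). The same expansion with edge products \<open>0\<close> shows \<open>det U = 1\<close>.

  Apart from \<open>1\<close> and \<open>- 1\<close>, the eigenvalues are therefore the zeros of \<open>z\<^sup>n\<^sup>+\<^sup>1 p(z) + q(z)\<close> with
  \<open>p(z) = z\<^sup>3 - z\<^sup>2 - 1\<close> and \<open>q(z) = z\<^sup>3 + z - 1\<close>. Let \<open>\<rho>\<close> be the real zero of \<open>p\<close>. For real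
  \<open>t\<close> with \<open>1 < t < \<rho>\<close> the number \<open>p(t)\<close> is negative, so the expression is eventually negative
  at \<open>t\<close>, while it equals \<open>q(\<rho>) > 0\<close> at \<open>\<rho>\<close>: a real eigenvalue exceeds \<open>t\<close>
  (\<open>ex_root_near_rho_max\<close>). In the other direction \<open>\<bar>p(z)\<bar> \<ge> p(\<bar>z\<bar>)\<close>, and \<open>p\<close> is bounded below
  by a positive constant on \<open>[s, \<infinity>)\<close> for \<open>s > \<rho>\<close>, so for large \<open>n\<close> the term
  \<open>z\<^sup>n\<^sup>+\<^sup>1 p(z)\<close> dominates \<open>q(z)\<close> as soon as \<open>\<bar>z\<bar> \<ge> s\<close>
  (\<open>roots_bounded_by_rho_max\<close>).
\<close>

section \<open>Determinants of matrices supported on a star\<close>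

text \<open>
  Index \<open>n\<close> is a leaf whose neighbour is \<open>k\<close>. Expanding along its row and then its column,
  the entries that link \<open>n\<close> and \<open>k\<close> occur only as the product \<open>f n k * f k n\<close>; it multiplies
  the principal minor without both indices.
\<close>

lemma det_leaf_expansion:
  fixes f :: "nat \<Rightarrow> nat \<Rightarrow> 'a :: comm_ring_1"
  assumes k: "k < n"
    and row: "\<And>j. j < n \<Longrightarrow> j \<noteq> k \<Longrightarrow> f n j = 0"
    and col: "\<And>j. j < n \<Longrightarrow> j \<noteq> k \<Longrightarrow> f j n = 0"
  shows "det (mat (Suc n) (Suc n) (\<lambda>(i, j). f i j)) =
    f n n * det (mat n n (\<lambda>(i, j). f i j)) -
    f n k * f k n *
      det (mat (n - 1) (n - 1) (\<lambda>(i, j). f (insert_index k i) (insert_index k j)))"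
proof -
  obtain m where n: "n = Suc m" using k by (cases n) auto
  define A where "A = mat (Suc n) (Suc n) (\<lambda>(i, j). f i j)"
  define B where "B = mat_delete A n k"
  have A: "A \<in> carrier_mat (Suc n) (Suc n)" by (simp add: A_def)
  have B: "B \<in> carrier_mat n n" unfolding B_def using mat_delete_carrier[OF A] by simp
  have "det A = (\<Sum>j<Suc n. A $$ (n, j) * cofactor A n j)"
    by (rule laplace_expansion_row[OF A]) simp
  also have "\<dots> = A $$ (n, n) * cofactor A n n + (\<Sum>j<n. A $$ (n, j) * cofactor A n j)"
    by simp
  also have "(\<Sum>j<n. A $$ (n, j) * cofactor A n j) =
      (\<Sum>j<n. if j = k then f n k * cofactor A n k else 0)"
    by (rule sum.cong) (auto simp: A_def row)
  also have "\<dots> = f n k * cofactor A n k" using k by simp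
  finally have detA: "det A = A $$ (n, n) * cofactor A n n + f n k * cofactor A n k" .
  have "mat_delete A n n = mat n n (\<lambda>(i, j). f i j)"
    by (rule eq_matI) (auto simp: mat_delete_def A_def)
  then have cof_nn: "cofactor A n n = det (mat n n (\<lambda>(i, j). f i j))"
    by (simp add: cofactor_def)
  have Bentry: "B $$ (i, m) = f i n" if "i < n" for i
    using that k n by (auto simp: B_def mat_delete_def A_def)
  have "det B = (\<Sum>i<n. B $$ (i, m) * cofactor B i m)"
    by (rule laplace_expansion_column[OF B]) (simp add: n)
  also have "\<dots> = (\<Sum>i<n. if i = k then f k n * cofactor B k m else 0)"
    by (rule sum.cong) (auto simp: Bentry col)
  also have "\<dots> = f k n * cofactor B k m" using k by simp
  finally have detB: "det B = f k n * cofactor B k m" .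
  have "mat_delete B k m =
      mat (n - 1) (n - 1) (\<lambda>(i, j). f (insert_index k i) (insert_index k j))"
    using k n by (intro eq_matI) (auto simp: mat_delete_def A_def B_def insert_index_def)
  then have cof_km: "cofactor B k m = (- 1) ^ (k + m) *
      det (mat (n - 1) (n - 1) (\<lambda>(i, j). f (insert_index k i) (insert_index k j)))"
    by (simp add: cofactor_def)
  have sign: "(- 1) ^ (n + k) * (- 1) ^ (k + m) = (- 1 :: 'a)"
  proof -
    have "n + k + (k + m) = Suc (2 * (m + k))" using n by simp
    then show ?thesis by (simp only: power_add[symmetric]) simp
  qed
  have "cofactor A n k = (- 1) ^ (n + k) * det B" by (simp add: cofactor_def B_def)
  also have "\<dots> = ((- 1) ^ (n + k) * (- 1) ^ (k + m)) * (f k n *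
      det (mat (n - 1) (n - 1) (\<lambda>(i, j). f (insert_index k i) (insert_index k j))))"
    by (simp add: detB cof_km mult_ac)
  finally have "cofactor A n k = - (f k n *
      det (mat (n - 1) (n - 1) (\<lambda>(i, j). f (insert_index k i) (insert_index k j))))"
    unfolding sign by simp
  with detA cof_nn show ?thesis by (simp add: A_def mult.assoc)
qed

text \<open>
  The neighbour of \<open>j > 0\<close> on the way to the branch vertex \<open>0\<close> in \<open>T\<^bsub>2,4,n\<^esub>\<close>: the branches
  start at \<open>1\<close>, \<open>2\<close> and \<open>5\<close>. It does not depend on \<open>n\<close>, so the leading minors of one matrix
  belong to shorter diagrams of the same family.
\<close>

definition star_parent :: "nat \<Rightarrow> nat" where
  "star_parent j = (if j \<in> {1, 2, 5} then 0 else j - 1)"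

text \<open>
  Only the product of the two entries of an edge is prescribed, since a leaf expansion sees
  nothing else. This covers \<open>U\<close> with products \<open>0\<close> and \<open>x U + U\<^sup>T\<close> with products \<open>x\<close>.
\<close>

definition star_weights :: "nat \<Rightarrow> 'a :: comm_ring_1 \<Rightarrow> 'a \<Rightarrow> (nat \<Rightarrow> nat \<Rightarrow> 'a) \<Rightarrow> bool" where
  "star_weights N a b f \<longleftrightarrow>
     (\<forall>i<N. f i i = a) \<and>
     (\<forall>j<N. \<forall>i<j. if i = star_parent j then f i j * f j i = b else f i j = 0 \<and> f j i = 0)"

lemma
  assumes "star_weights N a b f"
  shows star_weights_diag: "i < N \<Longrightarrow> f i i = a"
    and star_weights_edge:
      "j < N \<Longrightarrow> 0 < j \<Longrightarrow> f j (star_parent j) * f (star_parent j) j = b"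
    and star_weights_upper: "j < N \<Longrightarrow> i < j \<Longrightarrow> i \<noteq> star_parent j \<Longrightarrow> f i j = 0"
    and star_weights_lower: "j < N \<Longrightarrow> i < j \<Longrightarrow> i \<noteq> star_parent j \<Longrightarrow> f j i = 0"
proof -
  show "f j (star_parent j) * f (star_parent j) j = b" if "j < N" "0 < j"
  proof -
    have "star_parent j < j" using that by (simp add: star_parent_def)
    then have "f (star_parent j) j * f j (star_parent j) = b"
      using assms that unfolding star_weights_def by metis
    then show ?thesis by (simp add: mult.commute)
  qed
qed (use assms in \<open>auto simp: star_weights_def\<close>)

lemma star_leading_minor_step:
  fixes f :: "nat \<Rightarrow> nat \<Rightarrow> 'a :: comm_ring_1"
  assumes w: "star_weights N a b f" and n: "Suc n < N" and par: "star_parent (Suc n) = n"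
  shows "det (mat (Suc (Suc n)) (Suc (Suc n)) (\<lambda>(i, j). f i j)) =
    a * det (mat (Suc n) (Suc n) (\<lambda>(i, j). f i j)) - b * det (mat n n (\<lambda>(i, j). f i j))"
proof -
  have "mat n n (\<lambda>(i, j). f (insert_index n i) (insert_index n j)) = mat n n (\<lambda>(i, j). f i j)"
    by (rule eq_matI) auto
  then show ?thesis
    using det_leaf_expansion[of n "Suc n" f] star_weights_lower[OF w n] star_weights_upper[OF w n]
      star_weights_edge[OF w n] star_weights_diag[OF w n] par
    by simp
qed

lemma star_leading_minor_step_branch:
  fixes f :: "nat \<Rightarrow> nat \<Rightarrow> 'a :: comm_ring_1"
  assumes w: "star_weights N a b f" and n: "Suc n < N" and par: "star_parent (Suc n) = 0"
  shows "det (mat (Suc (Suc n)) (Suc (Suc n)) (\<lambda>(i, j). f i j)) =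
    a * det (mat (Suc n) (Suc n) (\<lambda>(i, j). f i j)) -
    b * det (mat n n (\<lambda>(i, j). f (Suc i) (Suc j)))"
proof -
  have "mat n n (\<lambda>(i, j). f (insert_index 0 i) (insert_index 0 j)) =
      mat n n (\<lambda>(i, j). f (Suc i) (Suc j))"
    by (rule eq_matI) auto
  then show ?thesis
    using det_leaf_expansion[of 0 "Suc n" f] star_weights_lower[OF w n] star_weights_upper[OF w n]
      star_weights_edge[OF w n] star_weights_diag[OF w n] par
    by simp
qed

lemma det_mat_one_by_one: "det (mat (Suc 0) (Suc 0) (\<lambda>(i, j). f i j)) = f 0 0"
  by (simp add: det_single)

text \<open>
  Without the branch vertex the diagram falls apart: vertex \<open>1\<close> is isolated from the path
  \<open>2, 3, 4\<close>. These are the minors left over when the first vertex of the second or of the third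
  branch is expanded as a leaf of the branch vertex.
\<close>

lemma star_minor_without_branch:
  fixes f :: "nat \<Rightarrow> nat \<Rightarrow> 'a :: comm_ring_1"
  assumes w: "star_weights N a b f" and N: "5 \<le> N"
  shows "det (mat 1 1 (\<lambda>(i, j). f (Suc i) (Suc j))) = a"
    and "det (mat 4 4 (\<lambda>(i, j). f (Suc i) (Suc j))) = a ^ 4 - 2 * a ^ 2 * b"
proof -
  define g where "g = (\<lambda>i j. f (Suc i) (Suc j))"
  define D where "D m = det (mat m m (\<lambda>(i, j). g i j))" for m
  \<comment> \<open>After the shift, the surviving edges of the path \<open>2, 3, 4\<close> are \<open>{1, 2}\<close> and \<open>{2, 3}\<close>.\<close>
  have g_zero: "g i j = 0" if "i < 4" "j < 4" "i \<noteq> j" "{i, j} \<noteq> {1, 2}" "{i, j} \<noteq> {2, 3}" for i j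
  proof (cases "i < j")
    case True
    then have "Suc i \<noteq> star_parent (Suc j)" using that by (auto simp: star_parent_def)
    then show ?thesis using star_weights_upper[OF w, of "Suc j" "Suc i"] True that N
      by (simp add: g_def)
  next
    case False
    then have "Suc j \<noteq> star_parent (Suc i)" using that by (auto simp: star_parent_def)
    then show ?thesis using star_weights_lower[OF w, of "Suc i" "Suc j"] False that N
      by (simp add: g_def)
  qed
  have g_diag: "g i i = a" if "i < 4" for i
    using star_weights_diag[OF w] that N by (simp add: g_def)
  have g_edge: "g i (i - 1) * g (i - 1) i = b" if "i = 2 \<or> i = 3" for i
    using star_weights_edge[OF w, of "Suc i"] that N
    by (auto simp: g_def star_parent_def eval_nat_numeral)
  have shift: "mat n n (\<lambda>(i, j). g (insert_index n i) (insert_index n j)) =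
      mat n n (\<lambda>(i, j). g i j)" for n
    by (rule eq_matI) auto
  have D1: "D 1 = a" using det_mat_one_by_one[of g] g_diag[of 0] by (simp add: D_def)
  have D2: "D 2 = a * D 1"
    using det_leaf_expansion[of 0 1 g] shift[of 0] g_zero[of 0 1] g_zero[of 1 0] g_diag[of 1]
    by (simp add: D_def numeral_2_eq_2 doubleton_eq_iff)
  have D3: "D 3 = a * D 2 - b * D 1"
    using det_leaf_expansion[of 1 2 g] shift[of 1] g_zero[of 0 2] g_zero[of 2 0] g_diag[of 2]
      g_edge[of 2]
    by (simp add: D_def eval_nat_numeral doubleton_eq_iff less_Suc_eq)
  have "g 3 j = 0" "g j 3 = 0" if "j < 3" "j \<noteq> 2" for j
    using that g_zero[of 3 j] g_zero[of j 3] by (simp_all add: doubleton_eq_iff)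
  from det_leaf_expansion[of 2 3 g, OF _ this]
  have D4: "D 4 = a * D 3 - b * D 2"
    using shift[of 2] g_diag[of 3] g_edge[of 3] unfolding D_def by simp
  show "det (mat 1 1 (\<lambda>(i, j). f (Suc i) (Suc j))) = a" using D1 by (simp add: D_def g_def)
  have "D 4 = a ^ 4 - 2 * a ^ 2 * b"
    unfolding D4 D3 D2 D1 by (simp add: algebra_simps eval_nat_numeral)
  then show "det (mat 4 4 (\<lambda>(i, j). f (Suc i) (Suc j))) = a ^ 4 - 2 * a ^ 2 * b"
    by (simp add: D_def g_def)
qed

text \<open>
  The minors of order \<open>5\<close> and \<open>6\<close> belong to \<open>T\<^bsub>2,4,1\<^esub>\<close> and \<open>T\<^bsub>2,4,2\<^esub>\<close>. The recurrence starts
  only from there, because vertex \<open>5\<close> hangs on the branch vertex and not on vertex \<open>4\<close>.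
\<close>

lemma star_leading_minors:
  fixes f :: "nat \<Rightarrow> nat \<Rightarrow> 'a :: comm_ring_1"
  assumes w: "star_weights N a b f" and N: "6 \<le> N"
  defines "D \<equiv> \<lambda>m. det (mat m m (\<lambda>(i, j). f i j))"
  shows "D 5 = a ^ 5 - 4 * a ^ 3 * b + 3 * a * b ^ 2"
    and "D 6 = a ^ 6 - 5 * a ^ 4 * b + 5 * a ^ 2 * b ^ 2"
    and "\<And>m. 5 \<le> m \<Longrightarrow> Suc m < N \<Longrightarrow> D (Suc (Suc m)) = a * D (Suc m) - b * D m"
proof -
  have D0: "D 0 = 1" by (simp add: D_def)
  have D1: "D 1 = a"
    using det_mat_one_by_one[of f] star_weights_diag[OF w, of 0] N by (simp add: D_def)
  have D2: "D 2 = a * D 1 - b * D 0"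
    using star_leading_minor_step[OF w, of 0] N
    by (simp add: D_def star_parent_def numeral_2_eq_2)
  have D3: "D 3 = a * D 2 - b * a"
    using star_leading_minor_step_branch[OF w, of 1] star_minor_without_branch(1)[OF w] N
    by (simp add: D_def star_parent_def eval_nat_numeral)
  have D4: "D 4 = a * D 3 - b * D 2"
    using star_leading_minor_step[OF w, of 2] N
    by (simp add: D_def star_parent_def eval_nat_numeral)
  have D5: "D 5 = a * D 4 - b * D 3"
    using star_leading_minor_step[OF w, of 3] N
    by (simp add: D_def star_parent_def eval_nat_numeral)
  have D6: "D 6 = a * D 5 - b * (a ^ 4 - 2 * a ^ 2 * b)"
    using star_leading_minor_step_branch[OF w, of 4] star_minor_without_branch(2)[OF w] N
    by (simp add: D_def star_parent_def eval_nat_numeral)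
  show D5': "D 5 = a ^ 5 - 4 * a ^ 3 * b + 3 * a * b ^ 2"
    unfolding D5 D4 D3 D2 D1 D0 by (simp add: algebra_simps eval_nat_numeral)
  show "D 6 = a ^ 6 - 5 * a ^ 4 * b + 5 * a ^ 2 * b ^ 2"
    unfolding D6 D5' by (simp add: algebra_simps eval_nat_numeral)
  show "D (Suc (Suc m)) = a * D (Suc m) - b * D m" if "5 \<le> m" "Suc m < N" for m
    using star_leading_minor_step[OF w, of m] that by (simp add: D_def star_parent_def)
qed

lemma star_det_no_edges:
  fixes f :: "nat \<Rightarrow> nat \<Rightarrow> 'a :: comm_ring_1"
  assumes w: "star_weights N 1 0 f" and N: "6 \<le> N"
  shows "det (mat N N (\<lambda>(i, j). f i j)) = 1"
proof -
  note minors = star_leading_minors[OF w N]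
  have "6 + k \<le> N \<Longrightarrow> det (mat (6 + k) (6 + k) (\<lambda>(i, j). f i j)) = 1" for k
  proof (induction k)
    case 0
    show ?case using minors(2) by simp
  next
    case (Suc k)
    then show ?case using minors(3)[of "5 + k"] by (simp add: eval_nat_numeral)
  qed
  from this[of "N - 6"] show ?thesis using N by simp
qed

text \<open>
  With \<open>a = x + 1\<close> and \<open>b = x\<close> the recurrence has the solutions \<open>x\<^sup>m\<close> and \<open>1\<close>. The
  difference \<open>x - 1\<close> of the characteristic roots is the denominator in the coefficients of the
  combination that has the two initial values, so multiplying by it stays inside the ring.
\<close>

lemma star_det_coxeter:
  fixes x :: "'a :: comm_ring_1"
  assumes w: "star_weights N (x + 1) x f" and N: "6 \<le> N" and m: "m + 5 \<le> N"
  shows "(x - 1) * det (mat (m + 5) (m + 5) (\<lambda>(i, j). f i j)) =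
    x ^ (m + 2) * (x ^ 4 - x ^ 2 - x - 1) + (x ^ 4 + x ^ 3 + x ^ 2 - 1)"
  using m
proof (induction m rule: induct_nat_012)
  case 0
  show ?case using star_leading_minors(1)[OF w N]
    by (simp add: algebra_simps eval_nat_numeral)
next
  case 1
  show ?case using star_leading_minors(2)[OF w N]
    by (simp add: algebra_simps eval_nat_numeral)
next
  case (ge2 m)
  define D where "D k = det (mat k k (\<lambda>(i, j). f i j))" for k
  have "D (m + 7) = (x + 1) * D (m + 6) - x * D (m + 5)"
    using star_leading_minors(3)[OF w N, of "m + 5"] ge2.prems
    by (simp add: D_def eval_nat_numeral)
  note rec = this
  have "(x - 1) * D (m + 7) = (x + 1) * ((x - 1) * D (m + 6)) - x * ((x - 1) * D (m + 5))"
    unfolding rec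
    by (simp add: algebra_simps)
  also have "(x - 1) * D (m + 6) =
      x ^ (m + 3) * (x ^ 4 - x ^ 2 - x - 1) + (x ^ 4 + x ^ 3 + x ^ 2 - 1)"
    using ge2.IH(2) ge2.prems by (simp add: D_def eval_nat_numeral)
  also have "(x - 1) * D (m + 5) =
      x ^ (m + 2) * (x ^ 4 - x ^ 2 - x - 1) + (x ^ 4 + x ^ 3 + x ^ 2 - 1)"
    using ge2.IH(1) ge2.prems by (simp add: D_def)
  also have "(x + 1) * (x ^ (m + 3) * (x ^ 4 - x ^ 2 - x - 1) + (x ^ 4 + x ^ 3 + x ^ 2 - 1)) -
      x * (x ^ (m + 2) * (x ^ 4 - x ^ 2 - x - 1) + (x ^ 4 + x ^ 3 + x ^ 2 - 1)) =
      x ^ (m + 4) * (x ^ 4 - x ^ 2 - x - 1) + (x ^ 4 + x ^ 3 + x ^ 2 - 1)"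
    by (simp add: algebra_simps eval_nat_numeral)
  finally show ?case by (simp add: D_def eval_nat_numeral)
qed

section \<open>Coxeter transformations as quotients of triangular matrices\<close>

text \<open>
  For a duplicate-free list, \<open>later vs i j\<close> means that \<open>j\<close> stands strictly behind \<open>i\<close>.
\<close>

fun later :: "'a list \<Rightarrow> 'a \<Rightarrow> 'a \<Rightarrow> bool" where
  "later [] i j \<longleftrightarrow> False"
| "later (v # vs) i j \<longleftrightarrow> (if i = v then j \<in> set vs else later vs i j)"

lemma later_in_set: "later vs i j \<Longrightarrow> j \<in> set vs"
  by (induction vs) (auto split: if_splits)

lemma later_linear:
  assumes "distinct vs" "i \<in> set vs" "j \<in> set vs" "i \<noteq> j"
  shows "later vs j i \<longleftrightarrow> \<not> later vs i j"
  using assms by (induction vs) (auto dest: later_in_set)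

lemma later_irrefl: "distinct vs \<Longrightarrow> \<not> later vs i i"
  by (induction vs) auto

definition reflections_product :: "real mat \<Rightarrow> nat list \<Rightarrow> real mat" where
  "reflections_product K vs = foldr (\<lambda>v M. simple_reflection_mat K v * M) vs (1\<^sub>m (dim_row K))"

lemma simple_reflection_mat_carrier:
  "K \<in> carrier_mat N N \<Longrightarrow> simple_reflection_mat K v \<in> carrier_mat N N"
  by (auto simp: simple_reflection_mat_def)

lemma reflections_product_carrier:
  "K \<in> carrier_mat N N \<Longrightarrow> reflections_product K vs \<in> carrier_mat N N"
  by (induction vs)
    (auto simp: reflections_product_def intro: mult_carrier_mat simple_reflection_mat_carrier)

lemma simple_reflection_mat_mult_entry:
  assumes K: "K \<in> carrier_mat N N" and M: "M \<in> carrier_mat N N"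
    and u: "u < N" and v: "v < N" and c: "c < N"
  shows "(simple_reflection_mat K u * M) $$ (v, c) =
    M $$ (v, c) - (if v = u then \<Sum>j<N. K $$ (u, j) * M $$ (j, c) else 0)"
proof -
  note S = simple_reflection_mat_carrier[OF K, of u]
  have "(simple_reflection_mat K u * M) $$ (v, c) = (simple_reflection_mat K u *\<^sub>v col M c) $ v"
    using S M v c by simp
  also have "\<dots> = simple_reflection K u (col M c) $ v"
    using M by (subst simple_reflection_mat_mult_vec[OF K u]) auto
  also have "\<dots> = M $$ (v, c) - (if v = u then \<Sum>j<N. K $$ (u, j) * M $$ (j, c) else 0)"
    using K M u v c by (auto simp: simple_reflection_def scalar_prod_def lessThan_atLeast0)
  finally show ?thesis .
qed

text \<open>
  The reflection at \<open>v\<close> changes coordinate \<open>v\<close> only, from its initial value \<open>e v\<close>. The rightmost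
  factor acts first, so at that moment the coordinates of the vertices behind \<open>v\<close> in the list
  already have their final values and all others still have their initial ones.
\<close>

lemma reflections_product_entry:
  assumes K: "K \<in> carrier_mat N N" and "distinct vs" and "set vs \<subseteq> {..<N}"
    and v: "v < N" and c: "c < N"
  defines "e \<equiv> \<lambda>j. if j = c then 1 else 0"
  shows "reflections_product K vs $$ (v, c) =
    e v - (if v \<in> set vs
      then \<Sum>j<N. K $$ (v, j) * (if later vs v j then reflections_product K vs $$ (j, c) else e j)
      else 0)"
  using assms(2,3) v
proof (induction vs arbitrary: v)
  case Nil
  then show ?case using K c by (simp add: reflections_product_def e_def)
next
  case (Cons u vs)
  define P where "P = reflections_product K vs"
  define P' where "P' = reflections_product K (u # vs)"
  have u: "u < N" and u_new: "u \<notin> set vs" and vs: "distinct vs" "set vs \<subseteq> {..<N}"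
    using Cons.prems by auto
  have IH: "P $$ (w, c) = e w - (if w \<in> set vs
      then \<Sum>j<N. K $$ (w, j) * (if later vs w j then P $$ (j, c) else e j) else 0)" if "w < N" for w
    unfolding P_def by (rule Cons.IH[OF vs that])
  have "P' = simple_reflection_mat K u * P" by (simp add: P'_def P_def reflections_product_def)
  then have P': "P' $$ (w, c) =
      P $$ (w, c) - (if w = u then \<Sum>j<N. K $$ (u, j) * P $$ (j, c) else 0)" if "w < N" for w
    using simple_reflection_mat_mult_entry[OF K reflections_product_carrier[OF K] u that c]
    by (simp add: P_def)
  have "P' $$ (v, c) = e v - (if v \<in> set (u # vs)
      then \<Sum>j<N. K $$ (v, j) * (if later (u # vs) v j then P' $$ (j, c) else e j) else 0)"
  proof (cases "v = u")
    case True
    have "(\<Sum>j<N. K $$ (u, j) * P $$ (j, c)) =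
        (\<Sum>j<N. K $$ (u, j) * (if j \<in> set vs then P' $$ (j, c) else e j))"
      using u_new by (intro sum.cong) (auto simp: P' IH)
    then show ?thesis using True u u_new by (simp add: P' IH[OF u])
  next
    case False
    have "(\<Sum>j<N. K $$ (v, j) * (if later vs v j then P $$ (j, c) else e j)) =
        (\<Sum>j<N. K $$ (v, j) * (if later vs v j then P' $$ (j, c) else e j))"
      using u_new by (intro sum.cong) (auto simp: P' dest: later_in_set)
    then show ?thesis using False Cons.prems(3) by (simp add: P' IH)
  qed
  then show ?case unfolding P'_def .
qed

definition order_splitting :: "real mat \<Rightarrow> nat list \<Rightarrow> real mat" where
  "order_splitting K vs = mat (dim_row K) (dim_row K)
     (\<lambda>(i, j). if i = j then 1 else if later vs i j then K $$ (i, j) else 0)"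

lemma order_splitting_carrier:
  "K \<in> carrier_mat N N \<Longrightarrow> order_splitting K vs \<in> carrier_mat N N"
  by (auto simp: order_splitting_def)

text \<open>
  This is \<open>reflections_product_entry\<close> with the final values collected on the left. On the
  diagonal the initial value \<open>1\<close> meets the diagonal entry \<open>2\<close> of \<open>K\<close>, which leaves \<open>- 1\<close>.
\<close>

lemma order_splitting_times_coxeter:
  assumes K: "K \<in> carrier_mat N N" and diag: "\<And>i. i < N \<Longrightarrow> K $$ (i, i) = 2"
    and sym: "\<And>i j. i < N \<Longrightarrow> j < N \<Longrightarrow> K $$ (i, j) = K $$ (j, i)"
    and vs: "distinct vs" "set vs = {..<N}"
  shows "order_splitting K vs * reflections_product K vs = - (order_splitting K vs)\<^sup>T"
proof (rule eq_matI)
  define U where "U = order_splitting K vs"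
  define C where "C = reflections_product K vs"
  have U: "U \<in> carrier_mat N N" and C: "C \<in> carrier_mat N N"
    using order_splitting_carrier[OF K] reflections_product_carrier[OF K]
    by (simp_all add: U_def C_def)
  fix v c assume "v < dim_row (- (order_splitting K vs)\<^sup>T)" "c < dim_col (- (order_splitting K vs)\<^sup>T)"
  then have v: "v < N" and c: "c < N" using order_splitting_carrier[OF K, of vs] by auto
  define e :: "nat \<Rightarrow> real" where "e j = (if j = c then 1 else 0)" for j
  have U_entry: "U $$ (i, j) = (if i = j then 1 else if later vs i j then K $$ (i, j) else 0)"
    if "i < N" "j < N" for i j
    using that K by (simp add: U_def order_splitting_def)
  have "C $$ (v, c) = e v - (\<Sum>j<N. K $$ (v, j) * (if later vs v j then C $$ (j, c) else e j))"
    using reflections_product_entry[OF K vs(1) _ v c] vs(2) v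
    unfolding C_def e_def by simp
  also have "(\<Sum>j<N. K $$ (v, j) * (if later vs v j then C $$ (j, c) else e j)) =
      (\<Sum>j<N. (if later vs v j then K $$ (v, j) * C $$ (j, c) else 0) +
        (if j = c then (if later vs v c then 0 else K $$ (v, c)) else 0))"
    by (rule sum.cong) (auto simp: e_def)
  also have "\<dots> = (\<Sum>j<N. if later vs v j then K $$ (v, j) * C $$ (j, c) else 0) +
      (if later vs v c then 0 else K $$ (v, c))"
    using c by (simp add: sum.distrib)
  finally have C_entry: "C $$ (v, c) + (\<Sum>j<N. if later vs v j then K $$ (v, j) * C $$ (j, c) else 0) =
      e v - (if later vs v c then 0 else K $$ (v, c))" by simp
  have "(U * C) $$ (v, c) = (\<Sum>j<N. U $$ (v, j) * C $$ (j, c))"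
    using U C v c by (simp add: scalar_prod_def lessThan_atLeast0)
  also have "\<dots> = (\<Sum>j<N. (if j = v then C $$ (v, c) else 0) +
      (if later vs v j then K $$ (v, j) * C $$ (j, c) else 0))"
    using v later_irrefl[OF vs(1), of v] by (intro sum.cong) (auto simp: U_entry)
  also have "\<dots> = e v - (if later vs v c then 0 else K $$ (v, c))"
    using v C_entry by (simp add: sum.distrib)
  also have "\<dots> = - U $$ (c, v)"
  proof (cases "v = c")
    case True
    then show ?thesis using later_irrefl[OF vs(1), of v] diag v by (simp add: e_def U_entry)
  next
    case False
    then have "later vs v c \<longleftrightarrow> \<not> later vs c v"
      using later_linear[OF vs(1), of c v] vs(2) v c by simp
    then show ?thesis using False sym[OF v c] v c by (simp add: e_def U_entry)
  qed
  finally show "(order_splitting K vs * reflections_product K vs) $$ (v, c) =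
      (- (order_splitting K vs)\<^sup>T) $$ (v, c)"
    using U v c by (simp add: U_def C_def)
qed (use order_splitting_carrier[OF K, of vs] reflections_product_carrier[OF K, of vs] in auto)

text \<open>
  As \<open>det U = 1\<close>, the determinant of \<open>x I - C\<close> is that of \<open>U (x I - C) = x U + U\<^sup>T\<close>.
\<close>

lemma char_poly_from_splitting:
  fixes U C :: "'a :: comm_ring_1 mat"
  assumes U: "U \<in> carrier_mat N N" and C: "C \<in> carrier_mat N N"
    and UC: "U * C = - U\<^sup>T" and det: "det U = 1"
  shows "char_poly C = det (mat N N (\<lambda>(i, j). [:U $$ (j, i), U $$ (i, j):]))"
proof -
  interpret const: comm_ring_hom "\<lambda>a :: 'a. [:a:]"
    by unfold_locales auto
  define U' where "U' = map_mat (\<lambda>a. [:a:]) U"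
  define R where "R = char_poly_matrix C"
  have U': "U' \<in> carrier_mat N N" and R: "R \<in> carrier_mat N N"
    using U C by (simp_all add: U'_def R_def)
  have "U' * R = mat N N (\<lambda>(i, j). [:U $$ (j, i), U $$ (i, j):])"
  proof (rule eq_matI)
    fix i j assume "i < dim_row (mat N N (\<lambda>(i, j). [:U $$ (j, i), U $$ (i, j):]))"
      "j < dim_col (mat N N (\<lambda>(i, j). [:U $$ (j, i), U $$ (i, j):]))"
    then have i: "i < N" and j: "j < N" by simp_all
    have "(U' * R) $$ (i, j) = (\<Sum>k<N. U' $$ (i, k) * R $$ (k, j))"
      using U' R i j by (simp add: scalar_prod_def lessThan_atLeast0)
    also have "\<dots> = (\<Sum>k<N. (if k = j then [:0, U $$ (i, j):] else 0) -
        [:U $$ (i, k) * C $$ (k, j):])"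
      using U C i j by (intro sum.cong) (auto simp: U'_def R_def char_poly_matrix_def)
    also have "\<dots> = [:0, U $$ (i, j):] - [:\<Sum>k<N. U $$ (i, k) * C $$ (k, j):]"
      using j by (simp add: sum_subtractf const.hom_sum)
    also have "(\<Sum>k<N. U $$ (i, k) * C $$ (k, j)) = (U * C) $$ (i, j)"
      using U C i j by (simp add: scalar_prod_def lessThan_atLeast0)
    also have "\<dots> = - U $$ (j, i)" using U i j by (simp add: UC)
    finally show "(U' * R) $$ (i, j) = mat N N (\<lambda>(i, j). [:U $$ (j, i), U $$ (i, j):]) $$ (i, j)"
      using i j by simp
  qed (use U' R in auto)
  moreover have "det U' = 1" unfolding U'_def const.hom_det det by (rule const.hom_one)
  ultimately show ?thesis
    using det_mult[OF U' R] by (simp add: char_poly_def R_def)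
qed

section \<open>The characteristic polynomial\<close>

lemma path_edges_Cons_upt:
  "path_edges (c # [a..<b]) = (if a < b then {{c, a}} else {}) \<union> {{i, Suc i} | i. a \<le> i \<and> Suc i < b}"
proof -
  have nth: "(c # [a..<b]) ! Suc i = a + i" if "a + i < b" for i using that by simp
  show ?thesis
  proof (intro equalityI subsetI)
    fix s assume "s \<in> path_edges (c # [a..<b])"
    then obtain i where i: "Suc i < Suc (b - a)" and s: "s = {(c # [a..<b]) ! i, (c # [a..<b]) ! Suc i}"
      by (auto simp: path_edges_def)
    show "s \<in> (if a < b then {{c, a}} else {}) \<union> {{i, Suc i} | i. a \<le> i \<and> Suc i < b}"
    proof (cases i)
      case 0
      then show ?thesis using i s by auto
    next
      case (Suc k)
      then have "s = {a + k, Suc (a + k)}" using i s by simp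
      then show ?thesis using i Suc by auto
    qed
  next
    fix s assume "s \<in> (if a < b then {{c, a}} else {}) \<union> {{i, Suc i} | i. a \<le> i \<and> Suc i < b}"
    then consider "a < b" "s = {c, a}" | i where "s = {i, Suc i}" "a \<le> i" "Suc i < b"
      by (auto split: if_splits)
    then show "s \<in> path_edges (c # [a..<b])"
    proof cases
      case 1
      then show ?thesis unfolding path_edges_def by (auto intro!: exI[of _ 0])
    next
      case 2
      then show ?thesis unfolding path_edges_def by (auto intro!: exI[of _ "Suc (i - a)"])
    qed
  qed
qed

lemma edge_in_branch:
  assumes "0 < a" "i < j"
  shows "{i, j} \<in> path_edges (0 # [a..<b]) \<longleftrightarrow>
    j < b \<and> (i = 0 \<and> j = a \<or> a \<le> i \<and> j = Suc i)"
proof -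
  have "{i, j} = {k, l} \<longleftrightarrow> i = k \<and> j = l" if "k < l" for k l
    using that assms(2) by (auto simp: doubleton_eq_iff)
  then show ?thesis using assms unfolding path_edges_Cons_upt by force
qed

lemma star_edges_parent:
  assumes "3 \<le> n" "i < j" "j < n + 4"
  shows "{i, j} \<in> star_edges 2 4 n \<longleftrightarrow> i = star_parent j"
proof -
  have "2 + 4 - 1 = (5 :: nat)" "2 + 4 + n - 2 = n + 4" by simp_all
  then have "{i, j} \<in> star_edges 2 4 n \<longleftrightarrow>
      {i, j} \<in> path_edges (0 # [1..<2]) \<or> {i, j} \<in> path_edges (0 # [2..<5]) \<or>
      {i, j} \<in> path_edges (0 # [5..<n + 4])"
    unfolding star_edges_def by (simp only: Un_iff disj_assoc)
  also have "\<dots> \<longleftrightarrow>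
      j < 2 \<and> (i = 0 \<and> j = 1 \<or> 1 \<le> i \<and> j = Suc i) \<or>
      j < 5 \<and> (i = 0 \<and> j = 2 \<or> 2 \<le> i \<and> j = Suc i) \<or>
      j < n + 4 \<and> (i = 0 \<and> j = 5 \<or> 5 \<le> i \<and> j = Suc i)"
    by (simp only: edge_in_branch assms zero_less_numeral zero_less_one)
  also have "\<dots> \<longleftrightarrow> (if j = 1 \<or> j = 2 \<or> j = 5 then i = 0 else i = j - 1)"
    using assms by presburger
  also have "\<dots> \<longleftrightarrow> i = star_parent j" by (simp add: star_parent_def)
  finally show ?thesis .
qed

text \<open>
  Multiplication by \<open>x - 1\<close> telescopes the geometric sum. Over an integral domain with
  \<open>x \<noteq> 1\<close>, this identity determines the expanded polynomial.
\<close>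

lemma coxeter_polynomial_times_x_minus_1:
  fixes x :: "'a :: comm_ring_1"
  assumes "3 \<le> n"
  shows "(x - 1) * (x ^ (n + 4) + x ^ (n + 3) - x ^ (n + 1) - 2 * (\<Sum>i=4..n. x ^ i) - x ^ 3 + x + 1) =
    x ^ (n + 1) * (x ^ 4 - x ^ 2 - x - 1) + (x ^ 4 + x ^ 3 + x ^ 2 - 1)"
proof -
  have geometric: "(x - 1) * (\<Sum>i=4..n. x ^ i) = x ^ (n + 1) - x ^ 4"
    using assms
  proof (induction n rule: dec_induct)
    case base
    show ?case by simp
  next
    case (step n)
    then show ?case by (simp add: algebra_simps)
  qed
  have "(x - 1) * (x ^ (n + 4) + x ^ (n + 3) - x ^ (n + 1) - 2 * (\<Sum>i=4..n. x ^ i) - x ^ 3 + x + 1) =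
      (x - 1) * (x ^ (n + 4) + x ^ (n + 3) - x ^ (n + 1) - x ^ 3 + x + 1) -
      2 * ((x - 1) * (\<Sum>i=4..n. x ^ i))"
    by (simp add: algebra_simps)
  also have "\<dots> = x ^ (n + 1) * (x ^ 4 - x ^ 2 - x - 1) + (x ^ 4 + x ^ 3 + x ^ 2 - 1)"
    unfolding geometric by (simp add: algebra_simps eval_nat_numeral)
  finally show ?thesis .
qed

lemma coxeter_polynomial_factor:
  fixes x :: "'a :: comm_ring_1"
  shows "x ^ (n + 1) * (x ^ 4 - x ^ 2 - x - 1) + (x ^ 4 + x ^ 3 + x ^ 2 - 1) =
    (x + 1) * (x ^ (n + 1) * (x ^ 3 - x ^ 2 - 1) + (x ^ 3 + x - 1))"
  by (simp add: algebra_simps eval_nat_numeral)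

lemma star_coxeter_char_poly:
  assumes n: "3 \<le> n"
    and cox: "is_coxeter_transformation (cartan_matrix (star_order 2 4 n) (star_edges 2 4 n)) C"
  defines "X \<equiv> [:0, 1:] :: real poly"
  shows "C \<in> carrier_mat (n + 4) (n + 4)"
    and "char_poly C =
      X ^ (n + 4) + X ^ (n + 3) - X ^ (n + 1) - 2 * (\<Sum>i=4..n. X ^ i) - X ^ 3 + X + 1"
proof -
  define N where "N = n + 4"
  define K where "K = cartan_matrix (star_order 2 4 n) (star_edges 2 4 n)"
  have N: "star_order 2 4 n = N" by (simp add: star_order_def N_def)
  have K: "K \<in> carrier_mat N N" by (simp add: K_def N cartan_matrix_def)
  have K_entry: "K $$ (i, j) = (if i = j then 2 else if {i, j} \<in> star_edges 2 4 n then -1 else 0)"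
    if "i < N" "j < N" for i j
    using that by (simp add: K_def N cartan_matrix_def)
  have K_diag: "K $$ (i, i) = 2" if "i < N" for i using that by (simp add: K_entry)
  have K_sym: "K $$ (i, j) = K $$ (j, i)" if "i < N" "j < N" for i j
    using that by (auto simp: K_entry insert_commute)
  have K_edge: "K $$ (i, j) = (if i = star_parent j then -1 else 0)" if "i < j" "j < N" for i j
    using that star_edges_parent[OF n, of i j] by (auto simp: K_entry N_def)
  obtain vs where vs: "distinct vs" "set vs = {..<N}" and C_eq: "C = reflections_product K vs"
    using cox K unfolding is_coxeter_transformation_def reflections_product_def K_def[symmetric]
    by auto
  have C: "C \<in> carrier_mat N N" unfolding C_eq by (rule reflections_product_carrier[OF K])
  then show "C \<in> carrier_mat (n + 4) (n + 4)" by (simp add: N_def)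

  define U where "U = order_splitting K vs"
  have U: "U \<in> carrier_mat N N" unfolding U_def by (rule order_splitting_carrier[OF K])
  have U_entry: "U $$ (i, j) = (if i = j then 1 else if later vs i j then K $$ (i, j) else 0)"
    if "i < N" "j < N" for i j
    using that K by (simp add: U_def order_splitting_def)
  \<comment> \<open>Exactly one end of an edge comes first, so exactly one of its two entries survives in \<open>U\<close>.\<close>
  have U_edge: "U $$ (i, j) = -1 \<and> U $$ (j, i) = 0 \<or> U $$ (i, j) = 0 \<and> U $$ (j, i) = -1"
    if "i < j" "j < N" "i = star_parent j" for i j
    using that later_linear[OF vs(1), of i j] vs(2) K_edge[of i j] K_sym[of i j]
    by (auto simp: U_entry)
  have U_nonedge: "U $$ (i, j) = 0 \<and> U $$ (j, i) = 0"
    if "i < j" "j < N" "i \<noteq> star_parent j" for i j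
    using that K_edge[of i j] K_sym[of i j] by (simp add: U_entry)
  have U_diag: "U $$ (i, i) = 1" if "i < N" for i using that by (simp add: U_entry)
  have "U $$ (i, j) * U $$ (j, i) = 0" if "i < j" "j < N" "i = star_parent j" for i j
    using U_edge[OF that] by auto
  then have "star_weights N 1 0 (\<lambda>i j. U $$ (i, j))"
    unfolding star_weights_def using U_nonedge by (simp add: U_diag)
  then have "det (mat N N (\<lambda>(i, j). U $$ (i, j))) = 1"
    using n by (intro star_det_no_edges) (simp_all add: N_def)
  moreover have "mat N N (\<lambda>(i, j). U $$ (i, j)) = U" using U by (intro eq_matI) auto
  ultimately have det_U: "det U = 1" by simp
  have "U * C = - U\<^sup>T"
    unfolding U_def C_eq by (rule order_splitting_times_coxeter[OF K K_diag K_sym vs])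
  then have char: "char_poly C = det (mat N N (\<lambda>(i, j). [:U $$ (j, i), U $$ (i, j):]))"
    by (rule char_poly_from_splitting[OF U C _ det_U])
  have "[:U $$ (j, i), U $$ (i, j):] * [:U $$ (i, j), U $$ (j, i):] = X"
    if "j < N" "i < j" "i = star_parent j" for i j
    using U_edge[OF that(2,1,3)] by (auto simp: X_def)
  then have weights: "star_weights N (X + 1) X (\<lambda>i j. [:U $$ (j, i), U $$ (i, j):])"
    unfolding star_weights_def using U_nonedge by (simp add: U_diag X_def one_pCons)
  have order: "n - 1 + 5 = N" "n - 1 + 2 = n + 1" using n by (simp_all add: N_def)
  have "(X - 1) * char_poly C =
      X ^ (n + 1) * (X ^ 4 - X ^ 2 - X - 1) + (X ^ 4 + X ^ 3 + X ^ 2 - 1)"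
    using star_det_coxeter[OF weights, of "n - 1"] n unfolding char order by (simp add: N_def)
  also have "\<dots> = (X - 1) * (X ^ (n + 4) + X ^ (n + 3) - X ^ (n + 1) -
      2 * (\<Sum>i=4..n. X ^ i) - X ^ 3 + X + 1)"
    by (rule coxeter_polynomial_times_x_minus_1[OF n, symmetric])
  finally show "char_poly C =
      X ^ (n + 4) + X ^ (n + 3) - X ^ (n + 1) - 2 * (\<Sum>i=4..n. X ^ i) - X ^ 3 + X + 1"
    by (subst (asm) mult_cancel_left) (auto simp: X_def one_pCons)
qed

section \<open>The cubic equation\<close>

lemma cubic_root_gt_one:
  assumes "x ^ 3 - x ^ 2 - 1 = (0 :: real)"
  shows "1 < x"
proof (rule ccontr)
  assume "\<not> 1 < x"
  then have "x ^ 2 * (x - 1) \<le> 0" by (simp add: mult_nonneg_nonpos)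
  then show False using assms by (simp add: algebra_simps eval_nat_numeral)
qed

lemma cubic_strict_mono:
  assumes "1 < x" "x < (y :: real)"
  shows "x ^ 3 - x ^ 2 - 1 < y ^ 3 - y ^ 2 - 1"
proof -
  have "x ^ 2 * (x - 1) < y ^ 2 * (y - 1)"
    using assms by (intro mult_strict_mono power_strict_mono) auto
  then show ?thesis by (simp add: algebra_simps eval_nat_numeral)
qed

lemma cubic_mono:
  assumes "1 < x" "x \<le> (y :: real)"
  shows "x ^ 3 - x ^ 2 - 1 \<le> y ^ 3 - y ^ 2 - 1"
  using cubic_strict_mono[of x y] assms by (cases "x = y") auto

lemma eventually_less_power:
  assumes "1 < (x :: real)"
  shows "\<forall>\<^sub>F n in sequentially. c < x ^ n"
proof -
  obtain m where m: "c < x ^ m" using real_arch_pow[OF assms] by blast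
  have "c < x ^ n" if "m \<le> n" for n
  proof -
    have "x ^ m \<le> x ^ n" using that assms by (intro power_increasing) auto
    with m show ?thesis by linarith
  qed
  then show ?thesis by (auto simp: eventually_sequentially)
qed

text \<open>
  With \<open>r = 1/3 + y\<close> the equation becomes \<open>y\<^sup>3 - y/3 - 29/27 = 0\<close>. The number \<open>y = u + v\<close> is a
  solution as soon as \<open>u v = 1/9\<close> and \<open>u\<^sup>3 + v\<^sup>3 = 29/27\<close>, and these conditions are met by the
  two cube roots.
\<close>

lemma cardano_root:
  defines "r \<equiv> 1 / 3 + root 3 (58 / 108 + sqrt (31 / 108)) + root 3 (58 / 108 - sqrt (31 / 108))"
  shows "r ^ 3 - r ^ 2 - 1 = 0"
proof -
  define s :: real where "s = sqrt (31 / 108)"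
  define u v where "u = root 3 (58 / 108 + s)" and "v = root 3 (58 / 108 - s)"
  have s2: "s ^ 2 = 31 / 108" by (simp add: s_def)
  have u3: "u ^ 3 = 58 / 108 + s" by (simp add: u_def odd_real_root_pow)
  have v3: "v ^ 3 = 58 / 108 - s" by (simp add: v_def odd_real_root_pow)
  have "u * v = root 3 ((58 / 108 + s) * (58 / 108 - s))"
    by (simp add: u_def v_def real_root_mult)
  also have "(58 / 108 + s) * (58 / 108 - s) = (1 / 9) ^ 3"
    using s2 by (simp add: algebra_simps power2_eq_square eval_nat_numeral)
  also have "root 3 ((1 / 9) ^ 3) = (1 / 9 :: real)" by (rule real_root_power_cancel) auto
  finally have uv: "u * v = 1 / 9" .
  have r: "r = 1 / 3 + u + v" by (simp add: r_def u_def v_def s_def)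
  have "r ^ 3 - r ^ 2 - 1 = (u ^ 3 + v ^ 3 - 29 / 27) + (3 * (u * v) - 1 / 3) * (u + v)"
    unfolding r by (simp add: power2_eq_square power3_eq_cube field_simps)
  then show ?thesis by (simp add: u3 v3 uv)
qed

text \<open>
  The cubic is \<open>x\<^sup>2 (x - 1) - 1\<close>, which is negative for \<open>x \<le> 1\<close> and strictly increasing
  beyond, so the set of real roots is a singleton and its maximum is that root.
\<close>

lemma rho_max_unique: "x ^ 3 - x ^ 2 - 1 = 0 \<longleftrightarrow> x = rho_max"
proof -
  obtain r :: real where r: "r ^ 3 - r ^ 2 - 1 = 0" using cardano_root by blast
  have "y = r" if "y ^ 3 - y ^ 2 - 1 = 0" for y :: real
    using cubic_strict_mono[of y r] cubic_strict_mono[of r y] that r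
      cubic_root_gt_one[OF that] cubic_root_gt_one[OF r]
    by (cases y r rule: linorder_cases) auto
  then have *: "y ^ 3 - y ^ 2 - 1 = 0 \<longleftrightarrow> y = r" for y :: real using r by blast
  then have "rho_max = r" by (simp add: rho_max_def)
  with * show ?thesis by simp
qed

lemma rho_max_root: "rho_max ^ 3 - rho_max ^ 2 - 1 = 0"
  using rho_max_unique[of rho_max] by blast

lemma rho_max_gt_one: "1 < rho_max"
  by (rule cubic_root_gt_one[OF rho_max_root])

lemma rho_max_approx: "\<bar>rho_max - 1.465571\<bar> < 0.0000005"
proof -
  have "1.4655705 < rho_max"
  proof (rule ccontr)
    assume "\<not> 1.4655705 < rho_max"
    then have "rho_max ^ 3 - rho_max ^ 2 - 1 \<le> 1.4655705 ^ 3 - 1.4655705 ^ 2 - (1 :: real)"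
      by (intro cubic_mono rho_max_gt_one) simp
    also have "\<dots> < 0" by (simp add: eval_nat_numeral)
    finally show False by (simp add: rho_max_root)
  qed
  moreover have "rho_max < 1.4655715"
  proof (rule ccontr)
    assume "\<not> rho_max < 1.4655715"
    then have "1.4655715 ^ 3 - 1.4655715 ^ 2 - (1 :: real) \<le> rho_max ^ 3 - rho_max ^ 2 - 1"
      by (intro cubic_mono) simp_all
    moreover have "0 < 1.4655715 ^ 3 - 1.4655715 ^ 2 - (1 :: real)" by (simp add: eval_nat_numeral)
    ultimately show False by (simp add: rho_max_root)
  qed
  ultimately show ?thesis unfolding abs_less_iff by simp
qed

section \<open>The limit of the spectral radius\<close>

text \<open>
  At \<open>t\<close> the power of \<open>t\<close> has a negative coefficient and outgrows the remaining summand; at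
  \<open>rho_max\<close> the coefficient vanishes and the remaining summand is positive. The intermediate
  value theorem gives a root in between.
\<close>

lemma ex_root_near_rho_max:
  assumes t: "1 < t" "t < rho_max"
  shows "\<forall>\<^sub>F n in sequentially. \<exists>x>t. x ^ (n + 1) * (x ^ 3 - x ^ 2 - 1) + (x ^ 3 + x - 1) = 0"
proof -
  define c where "c = - (t ^ 3 - t ^ 2 - 1)"
  have c: "0 < c" using cubic_strict_mono[OF t] rho_max_root by (simp add: c_def)
  have "\<forall>\<^sub>F n in sequentially. (t ^ 3 + t - 1) / c < t ^ n"
    by (rule eventually_less_power) (use t in simp)
  then show ?thesis
  proof eventually_elim
    case (elim n)
    define Q where "Q x = x ^ (n + 1) * (x ^ 3 - x ^ 2 - 1) + (x ^ 3 + x - 1)" for x :: real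
    have "(t ^ 3 + t - 1) < t ^ n * c" using elim c by (simp add: field_simps)
    also have "\<dots> \<le> t ^ (n + 1) * c" using t c by (intro mult_right_mono power_increasing) auto
    finally have neg: "Q t < 0" by (simp add: Q_def c_def algebra_simps)
    have "1 < rho_max ^ 3" using rho_max_gt_one by (simp add: one_less_power)
    then have "0 < rho_max ^ 3 + rho_max - 1" using rho_max_gt_one by linarith
    then have pos: "0 < Q rho_max" unfolding Q_def rho_max_root by simp
    have "\<exists>x\<ge>t. x \<le> rho_max \<and> Q x = 0"
      using neg pos t by (intro IVT') (auto simp: Q_def intro!: continuous_intros)
    then obtain x where "t \<le> x" "Q x = 0" by blast
    moreover have "x \<noteq> t" using neg \<open>Q x = 0\<close> by auto
    ultimately show ?case by (intro exI[of _ x]) (auto simp: Q_def)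
  qed
qed

text \<open>
  Put \<open>r = \<bar>z\<bar>\<close> and let \<open>d > 0\<close> be the value of the cubic at \<open>s\<close>. If \<open>r \<ge> s\<close>, then the
  first summand has modulus at least \<open>r\<^sup>n\<^sup>+\<^sup>1 d\<close> and the second at most \<open>3 r\<^sup>3\<close>. As soon as
  \<open>s\<^sup>n\<^sup>-\<^sup>2 d > 3\<close> they cannot cancel.
\<close>

lemma roots_bounded_by_rho_max:
  assumes s: "rho_max < s"
  shows "\<forall>\<^sub>F n in sequentially. \<forall>z :: complex.
    z ^ (n + 1) * (z ^ 3 - z ^ 2 - 1) + (z ^ 3 + z - 1) = 0 \<longrightarrow> cmod z < s"
proof -
  define d where "d = s ^ 3 - s ^ 2 - 1"
  have s1: "1 < s" using s rho_max_gt_one by simp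
  have d: "0 < d" using cubic_strict_mono[OF rho_max_gt_one s] rho_max_root by (simp add: d_def)
  have "\<forall>\<^sub>F n in sequentially. 3 * s ^ 2 / d < s ^ n"
    by (rule eventually_less_power) (use s1 in simp)
  then show ?thesis using eventually_ge_at_top[of 2]
  proof eventually_elim
    case (elim n)
    show ?case
    proof (intro allI impI, rule ccontr)
      fix z :: complex
      assume root: "z ^ (n + 1) * (z ^ 3 - z ^ 2 - 1) + (z ^ 3 + z - 1) = 0"
      assume "\<not> cmod z < s"
      define r where "r = cmod z"
      have rs: "s \<le> r" using \<open>\<not> cmod z < s\<close> by (simp add: r_def)
      have r1: "1 < r" using rs s1 by simp
      obtain k where k: "n = k + 2" using elim(2) by (metis le_add_diff_inverse2)
      \<comment> \<open>The triangle inequality bounds the modulus of the cubic below by its value at \<open>r\<close>.\<close>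
      have "d \<le> r ^ 3 - r ^ 2 - 1"
        unfolding d_def by (rule cubic_mono[OF s1 rs])
      also have "\<dots> \<le> cmod (z ^ 3 - z ^ 2 - 1)"
        using norm_triangle_ineq2[of "z ^ 3" "z ^ 2 + 1"] norm_triangle_ineq[of "z ^ 2" 1]
        by (simp add: r_def norm_power algebra_simps)
      finally have dz: "d \<le> cmod (z ^ 3 - z ^ 2 - 1)" .
      have "3 * s ^ 2 < (s ^ k * d) * s ^ 2"
        using elim(1) d by (simp add: k power_add pos_divide_less_eq power2_eq_square mult_ac)
      then have "3 < s ^ k * d" using s1 by (subst (asm) mult_less_cancel_right_pos) auto
      also have "\<dots> \<le> r ^ k * d" using rs s1 d by (intro mult_right_mono power_mono) auto
      finally have "3 * r ^ 3 < r ^ k * d * r ^ 3" using r1 by simp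
      also have "\<dots> = r ^ (n + 1) * d" by (simp add: k power_add eval_nat_numeral)
      also have "\<dots> \<le> r ^ (n + 1) * cmod (z ^ 3 - z ^ 2 - 1)"
        using dz r1 by (intro mult_left_mono) auto
      also have "\<dots> = cmod (z ^ (n + 1) * (z ^ 3 - z ^ 2 - 1))"
        by (simp only: norm_mult norm_power r_def)
      also have "z ^ (n + 1) * (z ^ 3 - z ^ 2 - 1) = - (z ^ 3 + z - 1)"
        using root by (simp only: eq_neg_iff_add_eq_0)
      also have "cmod (- (z ^ 3 + z - 1)) \<le> r ^ 3 + r + 1"
        unfolding norm_minus_cancel
        using norm_triangle_ineq4[of "z ^ 3 + z" 1] norm_triangle_ineq[of "z ^ 3" z]
        by (simp add: r_def norm_power)
      also have "\<dots> \<le> 3 * r ^ 3"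
        using power_increasing[of 1 3 r] one_le_power[of r 3] r1 by simp
      finally show False by simp
    qed
  qed
qed

text \<open>
  The value \<open>z = 1\<close> is excluded because it is a zero of the auxiliary factor \<open>x - 1\<close>; its modulus is
  below the limit in any case.
\<close>

lemma star_coxeter_eigenvalue:
  assumes n: "3 \<le> n"
    and cox: "is_coxeter_transformation (cartan_matrix (star_order 2 4 n) (star_edges 2 4 n)) C"
    and z: "z \<noteq> 1"
  shows "z \<in> spectrum (map_mat complex_of_real C) \<longleftrightarrow>
    z = -1 \<or> z ^ (n + 1) * (z ^ 3 - z ^ 2 - 1) + (z ^ 3 + z - 1) = 0"
proof -
  interpret of_real_poly: map_poly_comm_ring_hom complex_of_real ..
  note C = star_coxeter_char_poly(1)[OF n cox]
  define p where "p = poly (char_poly (map_mat complex_of_real C)) z"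
  have "map_poly complex_of_real [:0, 1:] = [:0, 1:]" by simp
  then have p: "p = z ^ (n + 4) + z ^ (n + 3) - z ^ (n + 1) - 2 * (\<Sum>i=4..n. z ^ i) - z ^ 3 + z + 1"
    unfolding p_def of_real_hom.char_poly_hom[OF C] star_coxeter_char_poly(2)[OF n cox]
    by (simp add: hom_distribs poly_sum)
  have "(z - 1) * p = (z + 1) * (z ^ (n + 1) * (z ^ 3 - z ^ 2 - 1) + (z ^ 3 + z - 1))"
    unfolding p coxeter_polynomial_times_x_minus_1[OF n] by (rule coxeter_polynomial_factor)
  moreover have "z \<in> spectrum (map_mat complex_of_real C) \<longleftrightarrow> p = 0"
    using eigenvalue_root_char_poly[of "map_mat complex_of_real C" "n + 4" z] C
    by (simp add: spectrum_def p_def)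
  ultimately show ?thesis using z by (metis add_eq_0_iff2 mult_eq_0_iff right_minus_eq)
qed

lemma spectral_radius_tendsto_rho_max:
  assumes cox: "\<And>n. 3 \<le> n \<Longrightarrow>
    is_coxeter_transformation (cartan_matrix (star_order 2 4 n) (star_edges 2 4 n)) (C n)"
  shows "(\<lambda>n. spectral_radius (map_mat complex_of_real (C n))) \<longlonglongrightarrow> rho_max"
proof (rule order_tendstoI)
  have carrier: "map_mat complex_of_real (C n) \<in> carrier_mat (n + 4) (n + 4)" if "3 \<le> n" for n
    using star_coxeter_char_poly(1)[OF that cox[OF that]] by simp
  fix a assume "a < rho_max"
  \<comment> \<open>The intermediate value argument needs a point above \<open>1\<close>.\<close>
  define t where "t = max a ((1 + rho_max) / 2)"
  have t: "1 < t" "t < rho_max" and "a \<le> t"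
    using rho_max_gt_one \<open>a < rho_max\<close> by (auto simp: t_def less_max_iff_disj)
  show "\<forall>\<^sub>F n in sequentially. a < spectral_radius (map_mat complex_of_real (C n))"
    using ex_root_near_rho_max[OF t] eventually_ge_at_top[of 3]
  proof eventually_elim
    case (elim n)
    then obtain x where x: "t < x" "x ^ (n + 1) * (x ^ 3 - x ^ 2 - 1) + (x ^ 3 + x - 1) = 0"
      by blast
    have "complex_of_real (x ^ (n + 1) * (x ^ 3 - x ^ 2 - 1) + (x ^ 3 + x - 1)) = 0"
      unfolding x(2) by simp
    then have "complex_of_real x \<in> spectrum (map_mat complex_of_real (C n))"
      using star_coxeter_eigenvalue[OF elim(2) cox[OF elim(2)], of "complex_of_real x"] x(1) t
      by simp
    then have "cmod (complex_of_real x) \<le> spectral_radius (map_mat complex_of_real (C n))"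
      by (intro spectral_radius_mem_max(2)[OF carrier[OF elim(2)]] imageI) simp_all
    then show ?case using x(1) t \<open>a \<le> t\<close> by simp
  qed
next
  have carrier: "map_mat complex_of_real (C n) \<in> carrier_mat (n + 4) (n + 4)" if "3 \<le> n" for n
    using star_coxeter_char_poly(1)[OF that cox[OF that]] by simp
  fix s assume s: "rho_max < s"
  show "\<forall>\<^sub>F n in sequentially. spectral_radius (map_mat complex_of_real (C n)) < s"
    using roots_bounded_by_rho_max[OF s] eventually_ge_at_top[of 3]
  proof eventually_elim
    case (elim n)
    obtain z where z: "z \<in> spectrum (map_mat complex_of_real (C n))"
      and radius: "spectral_radius (map_mat complex_of_real (C n)) = cmod z"
      using spectral_radius_mem_max(1)[OF carrier[OF elim(2)]] by auto
    have "cmod z < s"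
    proof (cases "z = 1 \<or> z = -1")
      case True
      then show ?thesis using s rho_max_gt_one by auto
    next
      case False
      then show ?thesis
        using z star_coxeter_eigenvalue[OF elim(2) cox[OF elim(2)], of z] elim(1) by blast
    qed
    then show ?case by (simp add: radius)
  qed
qed

theorem proposition4p19:
  fixes C :: "nat \<Rightarrow> real mat" and X :: "real poly"
  defines "X \<equiv> monom 1 1"
  assumes "\<And>n. n \<ge> 3 \<Longrightarrow>
    is_coxeter_transformation (cartan_matrix (star_order 2 4 n) (star_edges 2 4 n)) (C n)"
  shows
    "(\<forall>n\<ge>3.
        char_poly (C n) =
          X ^ (n + 4) + X ^ (n + 3) - X ^ (n + 1) - 2 * (\<Sum>i=4..n. X ^ i) - X ^ 3 + X + 1 \<and>
        (\<forall>t::real. t \<noteq> 1 \<longrightarrow>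
          poly (char_poly (C n)) t =
            (t ^ (n + 1) * (t ^ 4 - t ^ 2 - t - 1) + (t ^ 4 + t ^ 3 + t ^ 2 - 1)) / (t - 1) \<and>
          poly (char_poly (C n)) t =
            ((t + 1) * (t ^ (n + 1) * (t ^ 3 - t ^ 2 - 1) + (t ^ 3 + t - 1))) / (t - 1))) \<and>
     (\<lambda>n. spectral_radius (map_mat complex_of_real (C n))) \<longlonglongrightarrow> rho_max \<and>
     rho_max = 1 / 3 + root 3 (58 / 108 + sqrt (31 / 108)) + root 3 (58 / 108 - sqrt (31 / 108)) \<and>
     \<bar>rho_max - 1.465571\<bar> < 0.0000005"
proof (intro conjI allI impI)
  have X: "X = [:0, 1:]" by (simp add: X_def monom_Suc)
  fix n :: nat assume n: "3 \<le> n"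
  show char: "char_poly (C n) =
      X ^ (n + 4) + X ^ (n + 3) - X ^ (n + 1) - 2 * (\<Sum>i=4..n. X ^ i) - X ^ 3 + X + 1"
    unfolding X by (rule star_coxeter_char_poly(2)[OF n assms(2)[OF n]])
  fix t :: real assume t: "t \<noteq> 1"
  have "poly (char_poly (C n)) t =
      t ^ (n + 4) + t ^ (n + 3) - t ^ (n + 1) - 2 * (\<Sum>i=4..n. t ^ i) - t ^ 3 + t + 1"
    unfolding char X by (simp add: poly_sum)
  then have "(t - 1) * poly (char_poly (C n)) t =
      t ^ (n + 1) * (t ^ 4 - t ^ 2 - t - 1) + (t ^ 4 + t ^ 3 + t ^ 2 - 1)"
    using coxeter_polynomial_times_x_minus_1[OF n, of t] by simp
  then show quotient: "poly (char_poly (C n)) t =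
      (t ^ (n + 1) * (t ^ 4 - t ^ 2 - t - 1) + (t ^ 4 + t ^ 3 + t ^ 2 - 1)) / (t - 1)"
    using t by (simp add: eq_divide_eq mult.commute)
  show "poly (char_poly (C n)) t =
      ((t + 1) * (t ^ (n + 1) * (t ^ 3 - t ^ 2 - 1) + (t ^ 3 + t - 1))) / (t - 1)"
    unfolding quotient coxeter_polynomial_factor ..
next
  show "(\<lambda>n. spectral_radius (map_mat complex_of_real (C n))) \<longlonglongrightarrow> rho_max"
    by (rule spectral_radius_tendsto_rho_max[OF assms(2)])
next
  show "rho_max = 1 / 3 + root 3 (58 / 108 + sqrt (31 / 108)) + root 3 (58 / 108 - sqrt (31 / 108))"
    using cardano_root rho_max_unique by metis
qed (rule rho_max_approx)

end
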